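(* Let $G=(V,E)$ be a finite strongly connected simple digraph with $|V|=n$ and distance matrix $D$, such that both $DK=n\mathbf 1$ and $D^TK=n\mathbf 1$ admit solutions. Suppose that $G$ admits nonnegative in- and out-curvature $\mu^{\mathrm{in}},\mu^{\mathrm{out}}$. Then $$\overrightarrow{\mathrm{diam}}(G)\ \ge\ \frac{n^2}{n-1}\cdot\frac{1}{\|\mu^{\mathrm{in}}\|_{\ell_1}},$$ with equality if and only if $G=\overleftrightarrow{K_n}$.
   Context: A digraph is simple if it has no multiple arcs and no loops (opposite arcs may both be present); it is strongly connected if every vertex is reachable from every other by a directed path; $d(v,w)$ is the length of a shortest directed path from $v$ to $w$; $D=(d(v,w))_{v,w\in V}$; $\mathbf 1\in\mathbb R^n$ is the all-ones column vector. The directed diameter is $\overrightarrow{\mathrm{diam}}(G)=\max_{v,w\in V}d(v,w)$. $\overleftrightarrow{K_n}$ is the complete digraph on $n$ vertices, containing the arc $(u,v)$ for every ordered pair of distinct vertices. Steinerberger curvatures of the digraph: the out-curvature $\mu^{\mathrm{out}}:V\to\mathbb R$ is the solution of $DK=n\mathbf 1$ if it is unique, and if there are several solutions it is the one achieving $\max_K\min_i K_i$ over all solutions $K$; the in-curvature $\mu^{\mathrm{in}}:V\to\mathbb R$ is defined in the same way with $D^TK=n\mathbf 1$ in place of $DK=n\mathbf 1$. Thus $\sum_{w}d(v,w)\mu^{\mathrm{out}}(w)=n$ and $\sum_w d(w,v)\mu^{\mathrm{in}}(w)=n$ for all $v\in V$. Notation: $\|\mu\|_{\ell_1}=\sum_{w\in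 V}\mu(w)$. *)

theory Defs
  imports Complex_Main "Graph_Theory.Graph_Theory"
begin

text \<open>Length of a shortest directed path; only meaningful if \<open>w\<close> is reachable from \<open>v\<close>.\<close>
definition ddist :: "('a, 'b) pre_digraph \<Rightarrow> 'a \<Rightarrow> 'a \<Rightarrow> nat" where
  "ddist G v w = (LEAST k. \<exists>p. pre_digraph.apath G v p w \<and> length p = k)"

definition dist_matrix :: "('a, 'b) pre_digraph \<Rightarrow> 'a \<Rightarrow> 'a \<Rightarrow> real" where
  "dist_matrix G v w = real (ddist G v w)"

definition directed_diam :: "('a, 'b) pre_digraph \<Rightarrow> nat" where
  "directed_diam G = Max {ddist G v w | v w. v \<in> verts G \<and> w \<in> verts G}"

text \<open>
  The linear system \<open>M K = n 1\<close> with \<open>n = card V\<close>, for a real matrix \<open>M\<close> indexed by the finite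
  set \<open>V\<close>. Values of \<open>M\<close> and \<open>K\<close> outside \<open>V\<close> are irrelevant here and below.
\<close>
definition is_solution :: "'a set \<Rightarrow> ('a \<Rightarrow> 'a \<Rightarrow> real) \<Rightarrow> ('a \<Rightarrow> real) \<Rightarrow> bool" where
  "is_solution V M K \<longleftrightarrow> (\<forall>v\<in>V. (\<Sum>w\<in>V. M v w * K w) = real (card V))"

text \<open>
  \<open>\<mu>\<close> is a solution whose minimal entry is maximal among all solutions; if the solution is unique
  on \<open>V\<close>, the second conjunct is vacuous. This is a predicate rather than a function because the
  maximum may fail to exist and, if it exists, need not have a unique maximizer.
\<close>
definition is_curvature :: "'a set \<Rightarrow> ('a \<Rightarrow> 'a \<Rightarrow> real) \<Rightarrow> ('a \<Rightarrow> real) \<Rightarrow> bool" where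
  "is_curvature V M \<mu> \<longleftrightarrow>
     is_solution V M \<mu> \<and> (\<forall>K. is_solution V M K \<longrightarrow> Min (K ` V) \<le> Min (\<mu> ` V))"

definition is_out_curvature :: "('a, 'b) pre_digraph \<Rightarrow> ('a \<Rightarrow> real) \<Rightarrow> bool" where
  "is_out_curvature G = is_curvature (verts G) (dist_matrix G)"

definition is_in_curvature :: "('a, 'b) pre_digraph \<Rightarrow> ('a \<Rightarrow> real) \<Rightarrow> bool" where
  "is_in_curvature G = is_curvature (verts G) (\<lambda>v w. dist_matrix G w v)"

text \<open>Without absolute values; this is the usual norm for nonnegative \<open>\<mu>\<close>.\<close>
definition l1_norm :: "('a, 'b) pre_digraph \<Rightarrow> ('a \<Rightarrow> real) \<Rightarrow> real" where
  "l1_norm G \<mu> = (\<Sum>w\<in>verts G. \<mu> w)"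

text \<open>Agreement with the library's weighted distance for unit weights.\<close>
lemma (in fin_digraph) ddist_eq_unit_weight_distance:
  assumes "v \<rightarrow>\<^sup>* w"
  shows "ereal (real (ddist G v w)) = \<mu> (\<lambda>_. 1) v w"
proof -
  have cost: "awalk_cost (\<lambda>_. 1) p = real (length p)" for p :: "'b list"
    by (induction p) (auto simp: awalk_cost_def)
  obtain p where p: "apath v p w" "\<mu> (\<lambda>_. 1) v w = awalk_cost (\<lambda>_. 1) p"
    using min_cost_awalk[of v w "\<lambda>_. 1"] assms by auto
  have "length p \<le> length q" if "apath v q w" for q
    using min_cost_le_walk_cost[of v q w "\<lambda>_. 1"] p(2) that by (auto simp: cost apath_def)
  then have "ddist G v w = length p"
    unfolding ddist_def using p(1) by (intro Least_equality) auto
  then show ?thesis using p(2) by (simp add: cost)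
qed

end

theory Submission
  imports Defs
begin

text \<open>
  Double counting. Write \<open>T w = (\<Sum>v. d(w,v))\<close> for the total distance from \<open>w\<close>. Summing the
  \<open>n\<close> equations \<open>(\<Sum>w. d(w,v) \<mu> w) = n\<close> that say that \<open>\<mu>\<close> is an in-curvature, and exchanging
  the sums, gives \<open>(\<Sum>w. \<mu> w T w) = n\<^sup>2\<close> (\<open>in_curvature_weighted_distance_sum\<close>). Of the \<open>n\<close> terms of
  \<open>T w\<close> one is zero and the others are at most the diameter, so \<open>T w \<le> (n - 1) diam\<close>
  (\<open>distance_sum_le\<close>). For \<open>\<mu> \<ge> 0\<close> this yields \<open>n\<^sup>2 \<le> (n - 1) diam \<parallel>\<mu>\<parallel>\<close>, which is the claimed bound.

  In the case of equality, a vertex \<open>w\<close> with \<open>\<mu> w > 0\<close> must satisfy \<open>T w = (n - 1) diam\<close>: all other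
  vertices have distance exactly \<open>diam\<close> from \<open>w\<close>. But \<open>w\<close> has an out-neighbour, at distance \<open>1\<close>,
  so that one extremal vertex forces \<open>diam = 1\<close> (\<open>diam_eq_1_if_distance_sum_extremal\<close>), and
  this means that all ordered pairs of distinct vertices are joined by arcs
  (\<open>diam_eq_1_iff_complete\<close>). Conversely, if \<open>diam = 1\<close> then \<open>T w = n - 1\<close> for every \<open>w\<close>, and the
  estimate holds with equality.
\<close>

lemma (in wf_digraph) ex_apath_length_ddist:
  assumes "v \<rightarrow>\<^sup>* w"
  obtains p where "apath v p w" "length p = ddist G v w"
proof -
  obtain p where "apath v p w"
    using assms reachable_apath by blast
  then have "\<exists>k p. apath v p w \<and> length p = k"
    by blast
  from LeastI_ex[OF this] show ?thesis
    using that unfolding ddist_def by blast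
qed

lemma (in wf_digraph) ddist_le_length:
  "apath v p w \<Longrightarrow> ddist G v w \<le> length p"
  unfolding ddist_def by (rule Least_le) blast

lemma (in wf_digraph) ddist_self:
  "v \<in> verts G \<Longrightarrow> ddist G v v = 0"
  using ddist_le_length[of v "[]" v] by (simp add: apath_Nil_iff)

lemma (in wf_digraph) ddist_pos:
  assumes "v \<rightarrow>\<^sup>* w" "v \<noteq> w"
  shows "ddist G v w > 0"
proof -
  obtain p where "apath v p w" "length p = ddist G v w"
    using ex_apath_length_ddist[OF assms(1)] .
  with assms(2) show ?thesis
    by (cases p) (auto simp: apath_Nil_iff)
qed

lemma (in loopfree_digraph) ddist_le_1_if_arc:
  assumes "v \<rightarrow> w"
  shows "ddist G v w \<le> 1"
proof -
  obtain e where e: "e \<in> arcs G" "tail G e = v" "head G e = w"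
    using assms by (auto simp: arcs_ends_conv)
  then have "apath v [e] w"
    using no_loops[of e] by (auto simp: apath_simps)
  from ddist_le_length[OF this] show ?thesis
    by simp
qed

lemma (in wf_digraph) arc_if_ddist_eq_1:
  assumes "v \<rightarrow>\<^sup>* w" "ddist G v w = 1"
  shows "v \<rightarrow> w"
proof -
  obtain p where "apath v p w" "length p = 1"
    using ex_apath_length_ddist[OF assms(1)] assms(2) by metis
  then obtain e where "e \<in> arcs G" "tail G e = v" "head G e = w"
    by (auto simp: length_Suc_conv apath_simps)
  then show ?thesis
    by (auto simp: arcs_ends_conv)
qed

lemma (in fin_digraph) ddist_le_directed_diam:
  assumes "v \<in> verts G" "w \<in> verts G"
  shows "ddist G v w \<le> directed_diam G"
proof -
  have "{ddist G v w | v w. v \<in> verts G \<and> w \<in> verts G}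
      = (\<lambda>(v, w). ddist G v w) ` (verts G \<times> verts G)"
    by auto
  then have "finite {ddist G v w | v w. v \<in> verts G \<and> w \<in> verts G}"
    by simp
  then show ?thesis
    unfolding directed_diam_def using assms by (intro Max_ge) auto
qed

lemma (in fin_digraph) directed_diam_attained:
  assumes "verts G \<noteq> {}"
  obtains v w where "v \<in> verts G" "w \<in> verts G" "ddist G v w = directed_diam G"
proof -
  have eq: "{ddist G v w | v w. v \<in> verts G \<and> w \<in> verts G}
      = (\<lambda>(v, w). ddist G v w) ` (verts G \<times> verts G)"
    by auto
  have "directed_diam G \<in> {ddist G v w | v w. v \<in> verts G \<and> w \<in> verts G}"
    unfolding directed_diam_def using assms by (intro Max_in) (auto simp: eq)
  then show ?thesis
    using that by auto
qed

lemma (in wf_digraph) ex_out_neighbour: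
  assumes "v \<rightarrow>\<^sup>* w" "v \<noteq> w"
  obtains x where "v \<rightarrow> x"
  using assms by (meson reachable_neq_reachable1 converse_tranclE)

lemma (in fin_digraph) sum_ddist_remove_self:
  assumes "w \<in> verts G"
  shows "(\<Sum>v\<in>verts G. ddist G w v) = (\<Sum>v\<in>verts G - {w}. ddist G w v)"
  using assms by (simp add: sum.remove ddist_self)

lemma (in fin_digraph) distance_sum_le:
  assumes "w \<in> verts G"
  shows "(\<Sum>v\<in>verts G. ddist G w v) \<le> (card (verts G) - 1) * directed_diam G"
  using sum_bounded_above[of "verts G - {w}" "ddist G w" "directed_diam G"]
    assms ddist_le_directed_diam
  by (simp add: sum_ddist_remove_self)

text \<open>
  The first arc of a path that leaves \<open>w\<close> ends at a vertex at distance exactly \<open>1\<close> from \<open>w\<close>, so all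
  the other vertices can lie at one common distance from \<open>w\<close> only if this distance is \<open>1\<close>.
\<close>
lemma (in digraph) diam_eq_1_if_distance_sum_extremal:
  assumes sc: "strongly_connected G" and n: "card (verts G) \<ge> 2" and w: "w \<in> verts G"
    and eq: "(\<Sum>v\<in>verts G. ddist G w v) = (card (verts G) - 1) * directed_diam G"
  shows "directed_diam G = 1"
proof -
  have "verts G - {w} \<noteq> {}"
  proof
    assume "verts G - {w} = {}"
    then have "card (verts G) \<le> card {w}"
      by (intro card_mono) auto
    with n show False
      by simp
  qed
  then obtain u where u: "u \<in> verts G" "u \<noteq> w"
    by blast
  then have "w \<rightarrow>\<^sup>* u"
    using sc w by (auto simp: strongly_connected_def)
  then obtain x where x: "w \<rightarrow> x"
    using ex_out_neighbour u(2) by metis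
  then have xV: "x \<in> verts G - {w}"
    using adj_in_verts(2) adj_not_same by blast
  have "(\<Sum>v\<in>verts G - {w}. directed_diam G - ddist G w v) = 0"
    using eq w ddist_le_directed_diam
    by (subst sum_subtractf_nat) (auto simp: sum_ddist_remove_self)
  then have "directed_diam G \<le> ddist G w x"
    using xV by simp
  moreover have "ddist G w x \<le> directed_diam G"
    using w xV by (intro ddist_le_directed_diam) auto
  moreover have "ddist G w x > 0"
    using sc w xV by (intro ddist_pos) (auto simp: strongly_connected_def)
  ultimately show ?thesis
    using ddist_le_1_if_arc[OF x] by simp
qed

lemma (in fin_digraph) ddist_eq_1_if_diam_eq_1:
  assumes "strongly_connected G" "directed_diam G = 1"
    and "v \<in> verts G" "w \<in> verts G" "v \<noteq> w"
  shows "ddist G v w = 1"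
proof -
  have "ddist G v w > 0"
    using assms by (intro ddist_pos) (auto simp: strongly_connected_def)
  moreover have "ddist G v w \<le> 1"
    using ddist_le_directed_diam[of v w] assms by simp
  ultimately show ?thesis
    by simp
qed

lemma (in digraph) diam_eq_1_iff_complete:
  assumes sc: "strongly_connected G" and n: "card (verts G) \<ge> 2"
  shows "directed_diam G = 1 \<longleftrightarrow> complete_digraph (card (verts G)) G"
proof
  assume diam: "directed_diam G = 1"
  have "v \<rightarrow> w" if "v \<in> verts G" "w \<in> verts G" "v \<noteq> w" for v w
    using that sc ddist_eq_1_if_diam_eq_1[OF sc diam that]
    by (intro arc_if_ddist_eq_1) (auto simp: strongly_connected_def)
  then have arcs: "arcs_ends G = {(u, v). (u, v) \<in> verts G \<times> verts G \<and> u \<noteq> v}"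
    using no_loops by (auto simp: arcs_ends_conv)
  then have "graph G"
    by (intro graphI) (auto simp: symmetric_def sym_def)
  with arcs show "complete_digraph (card (verts G)) G"
    by (simp add: complete_digraph_def)
next
  assume "complete_digraph (card (verts G)) G"
  then have arcs: "arcs_ends G = {(u, v). (u, v) \<in> verts G \<times> verts G \<and> u \<noteq> v}"
    by (simp add: complete_digraph_def)
  have "verts G \<noteq> {}"
    using n by auto
  then obtain v w where vw: "v \<in> verts G" "w \<in> verts G" "ddist G v w = directed_diam G"
    using directed_diam_attained by blast
  have le: "directed_diam G \<le> 1"
  proof (cases "v = w")
    case True
    then show ?thesis
      using vw ddist_self by simp
  next
    case False
    then show ?thesis
      using vw arcs ddist_le_1_if_arc[of v w] by auto
  qed
  have "\<not> verts G \<subseteq> {v}"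
    using n card_mono[of "{v}" "verts G"] by auto
  then obtain u where "u \<in> verts G" "u \<noteq> v"
    by blast
  then have "0 < ddist G v u" "ddist G v u \<le> directed_diam G"
    using sc vw by (auto simp: strongly_connected_def intro!: ddist_pos ddist_le_directed_diam)
  with le show "directed_diam G = 1"
    by simp
qed

lemma in_curvature_weighted_distance_sum:
  assumes "is_in_curvature G \<mu>"
  shows "(\<Sum>w\<in>verts G. \<mu> w * real (\<Sum>v\<in>verts G. ddist G w v)) = real (card (verts G))^2"
proof -
  have "(\<Sum>w\<in>verts G. \<mu> w * real (\<Sum>v\<in>verts G. ddist G w v))
      = (\<Sum>w\<in>verts G. \<Sum>v\<in>verts G. dist_matrix G w v * \<mu> w)"
    by (simp add: dist_matrix_def sum_distrib_left mult.commute)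
  also have "\<dots> = (\<Sum>v\<in>verts G. \<Sum>w\<in>verts G. dist_matrix G w v * \<mu> w)"
    by (rule sum.swap)
  also have "\<dots> = (\<Sum>v\<in>verts G. real (card (verts G)))"
    using assms by (simp add: is_in_curvature_def is_curvature_def is_solution_def)
  finally show ?thesis
    by (simp add: power2_eq_square)
qed

text \<open>
  On a single vertex the distance matrix is zero, so the system cannot be solved. This is what makes
  the division by \<open>n - 1\<close> in the main estimate legitimate.
\<close>
lemma (in fin_digraph) card_verts_ge_2_if_solution:
  assumes "verts G \<noteq> {}" "is_solution (verts G) (dist_matrix G) K"
  shows "card (verts G) \<ge> 2"
proof (rule ccontr)
  assume "\<not> card (verts G) \<ge> 2"
  moreover have "card (verts G) \<noteq> 0"
    using assms(1) by simp
  ultimately have "card (verts G) = 1"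
    by linarith
  then obtain v where "verts G = {v}"
    by (auto simp: card_1_singleton_iff)
  then show False
    using assms(2) ddist_self[of v] by (simp add: is_solution_def dist_matrix_def)
qed

theorem theorem4p10:
  fixes G :: "('a, 'b) pre_digraph" and n :: nat
    and \<mu>_in \<mu>_out :: "'a \<Rightarrow> real"
  assumes "digraph G"
    and "strongly_connected G"
    and "card (verts G) = n"
    and "\<exists>K. is_solution (verts G) (dist_matrix G) K"
    and "\<exists>K. is_solution (verts G) (\<lambda>v w. dist_matrix G w v) K"
    and "is_in_curvature G \<mu>_in" and "\<forall>v\<in>verts G. 0 \<le> \<mu>_in v"
    and "is_out_curvature G \<mu>_out" and "\<forall>v\<in>verts G. 0 \<le> \<mu>_out v"
  shows "real (directed_diam G) \<ge> (real n)^2 / (real n - 1) * (1 / l1_norm G \<mu>_in)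
    \<and> (real (directed_diam G) = (real n)^2 / (real n - 1) * (1 / l1_norm G \<mu>_in)
        \<longleftrightarrow> complete_digraph n G)"
proof -
  interpret digraph G by fact
  define \<Delta> where "\<Delta> = directed_diam G"
  define s where "s = l1_norm G \<mu>_in"
  define T where "T w = (\<Sum>v\<in>verts G. ddist G w v)" for w
  have sc: "strongly_connected G" by fact
  have card: "card (verts G) = n" by fact
  have n: "n \<ge> 2"
    using card_verts_ge_2_if_solution sc assms(4) card by (auto simp: strongly_connected_def)
  have pos: "\<mu>_in w \<ge> 0" if "w \<in> verts G" for w
    using assms(7) that by blast
  have s: "s = (\<Sum>w\<in>verts G. \<mu>_in w)"
    by (simp add: s_def l1_norm_def)
  have T_le: "real (T w) \<le> (real n - 1) * \<Delta>" if "w \<in> verts G" for w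
  proof -
    have "T w \<le> (n - 1) * \<Delta>"
      using distance_sum_le[OF that] by (simp add: T_def \<Delta>_def card)
    then have "real (T w) \<le> real ((n - 1) * \<Delta>)"
      by (rule of_nat_mono)
    then show ?thesis
      using n by (simp add: of_nat_diff)
  qed
  have weighted: "(\<Sum>w\<in>verts G. \<mu>_in w * real (T w)) = (real n)^2"
    using in_curvature_weighted_distance_sum[OF assms(6)] by (simp add: T_def card)

  \<comment> \<open>The slack in the estimate is a sum of nonnegative terms, one for each vertex, so equality can be
    read off termwise.\<close>
  have slack: "(real n - 1) * \<Delta> * s - (real n)^2
      = (\<Sum>w\<in>verts G. \<mu>_in w * ((real n - 1) * \<Delta> - real (T w)))"
    by (simp add: s weighted[symmetric] right_diff_distrib sum_subtractf sum_distrib_left mult_ac)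
  have slack_nonneg: "0 \<le> \<mu>_in w * ((real n - 1) * \<Delta> - real (T w))" if "w \<in> verts G" for w
    using pos T_le that by simp
  have "0 \<le> (\<Sum>w\<in>verts G. \<mu>_in w * ((real n - 1) * \<Delta> - real (T w)))"
    by (intro sum_nonneg slack_nonneg)
  then have bound: "(real n)^2 \<le> (real n - 1) * \<Delta> * s"
    using slack by simp

  have "s \<noteq> 0"
    using bound n by auto
  moreover have "s \<ge> 0"
    unfolding s by (intro sum_nonneg pos)
  ultimately have s_pos: "s > 0"
    by simp
  have n1_pos: "real n - 1 > 0"
    using n by simp

  have equality: "(real n - 1) * \<Delta> * s = (real n)^2 \<longleftrightarrow> complete_digraph n G"
  proof
    assume "(real n - 1) * \<Delta> * s = (real n)^2"
    then have "(\<Sum>w\<in>verts G. \<mu>_in w * ((real n - 1) * \<Delta> - real (T w))) = 0"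
      using slack by simp
    then have zero: "\<forall>w\<in>verts G. \<mu>_in w * ((real n - 1) * \<Delta> - real (T w)) = 0"
      by (subst (asm) sum_nonneg_eq_0_iff) (auto intro: slack_nonneg)
    obtain w where w: "w \<in> verts G" "\<mu>_in w \<noteq> 0"
      using s_pos unfolding s by (metis less_irrefl sum.neutral)
    have "real (T w) = (real n - 1) * \<Delta>"
      using zero w by auto
    also have "\<dots> = real ((n - 1) * \<Delta>)"
      using n by (simp add: of_nat_diff)
    finally have "T w = (n - 1) * \<Delta>"
      by (simp only: of_nat_eq_iff)
    then have "\<Delta> = 1"
      using diam_eq_1_if_distance_sum_extremal[OF sc _ w(1)] n by (simp add: T_def \<Delta>_def card)
    then show "complete_digraph n G"
      using diam_eq_1_iff_complete[OF sc] n by (simp add: \<Delta>_def card)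
  next
    assume "complete_digraph n G"
    then have diam: "directed_diam G = 1"
      using diam_eq_1_iff_complete[OF sc] n by (simp add: card)
    have "real (T w) = real n - 1" if "w \<in> verts G" for w
    proof -
      have "T w = (\<Sum>v\<in>verts G - {w}. 1)"
        unfolding T_def sum_ddist_remove_self[OF that]
        using ddist_eq_1_if_diam_eq_1[OF sc diam that] by (intro sum.cong) auto
      then show ?thesis
        using that n by (simp add: card of_nat_diff)
    qed
    then have "(\<Sum>w\<in>verts G. \<mu>_in w * ((real n - 1) * \<Delta> - real (T w))) = 0"
      using diam by (simp add: \<Delta>_def)
    then show "(real n - 1) * \<Delta> * s = (real n)^2"
      using slack by simp
  qed

  have "(real n)^2 / (real n - 1) * (1 / s) = (real n)^2 / ((real n - 1) * s)"
    by simp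
  moreover have "(real n)^2 / ((real n - 1) * s) \<le> \<Delta> \<longleftrightarrow> (real n)^2 \<le> (real n - 1) * \<Delta> * s"
    using s_pos n1_pos by (simp add: pos_divide_le_eq mult_ac)
  moreover have "\<Delta> = (real n)^2 / ((real n - 1) * s) \<longleftrightarrow> (real n - 1) * \<Delta> * s = (real n)^2"
    using s_pos n1_pos by (simp add: eq_divide_eq mult_ac)
  ultimately show ?thesis
    using bound equality unfolding \<Delta>_def s_def by simp
qed

end
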